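(* Let $\Omega\subset\mathbb{R}^3$ be a domain, let $(\alpha)=(\alpha_1,\alpha_2,\alpha_3)$ with $\alpha_k\in(0,1]$, and let $\omega,\epsilon,\mu$ be nonzero constants. Put $\sigma=-i\omega\epsilon$ and $\lambda=\omega\sqrt{\epsilon\mu}$, the square root being chosen so that $\operatorname{Im}\lambda\ge 0$. Let $\vec E,\vec H\in C^1(\Omega;\mathbb{C}^3)$ satisfy $\mathrm{div}_{(\alpha)}[\vec E]=0$ and $\mathrm{div}_{(\alpha)}[\vec H]=0$ in $\Omega$, and define $$\vec\varphi:=-i\omega\epsilon\vec E+\lambda\vec H,\qquad \vec\psi:=i\omega\epsilon\vec E+\lambda\vec H .$$ Then $(\vec\varphi,\vec\psi)$ satisfies in $\Omega$ the quaternionic equation $$\mathcal{M}^{(\alpha)}_{\lambda}\begin{pmatrix}\vec\varphi\\ \vec\psi\end{pmatrix}=0,\qquad \mathcal{M}^{(\alpha)}_{\lambda}:=\begin{pmatrix} D_{MT}^{(\alpha)}-\lambda & 0\\ 0 & D_{MT}^{(\alpha)}+\lambda\end{pmatrix},$$ if and only if $(\vec E,\vec H)$ satisfies in $\Omega$ the system $$\mathrm{curl}_{(\alpha)}[\vec H]=\sigma\vec E,\quad \mathrm{curl}_{(\alpha)}[\vec E]=i\omega\mu\vec H,\quad \mathrm{div}_{(\alpha)}[\vec H]=0,\quad \mathrm{div}_{(\alpha)}[\vec E]=0 .$$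
   Context: For $\alpha\in(0,1]$ and $x\in\mathbb{R}$ put $c_1(\alpha,x)=\frac{\pi^{\alpha/2}}{\Gamma(\alpha/2)}|x|^{\alpha-1}$, so that $\frac{1}{c_1(\alpha,x)}=\frac{\Gamma(\alpha/2)}{\pi^{\alpha/2}}|x|^{1-\alpha}$ (equal to $1$ when $\alpha=1$). With $\mathbf e_1,\mathbf e_2,\mathbf e_3$ the standard basis of $\mathbb{R}^3$, identified with the quaternionic imaginary units ($\mathbf e_1^2=\mathbf e_2^2=\mathbf e_3^2=\mathbf e_1\mathbf e_2\mathbf e_3=-1$), and $\epsilon_{ijk}$ the Levi-Civita symbol, the non-integer dimensional space (NIDS) operators are $$\mathrm{grad}_{(\alpha)}[f]=\sum_{k=1}^3\mathbf e_k\frac{1}{c_1(\alpha_k,x_k)}\frac{\partial f}{\partial x_k},\qquad \mathrm{div}_{(\alpha)}[\vec g]=\sum_{k=1}^3\frac{1}{c_1(\alpha_k,x_k)}\frac{\partial g_k}{\partial x_k},$$ $$\mathrm{curl}_{(\alpha)}[\vec g]=\sum_{i,j,k=1}^3\mathbf e_i\,\epsilon_{ijk}\frac{1}{c_1(\alpha_j,x_j)}\frac{\partial g_k}{\partial x_j}.$$ They are applied to complex-valued functions and fields by linearity. $\mathbb{H}(\mathbb{C})$ denotes the complex quaternions $a=a_0+\vec a$, $\vec a=\sum_{k=1}^3 a_k\mathbf e_k$, $a_k\in\mathbb{C}$, where the complex unit $i$ commutes with each $\mathbf e_k$; a field with values in $\mathbb{C}^3$ is identified with an $\mathbb{H}(\mathbb{C})$-valued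 function with zero scalar part. For an $\mathbb{H}(\mathbb{C})$-valued function $f=f_0+\vec f$, the NIDS Moisil-Teodorescu operator is $$D_{MT}^{(\alpha)}[f]=-\mathrm{div}_{(\alpha)}[\vec f]+\mathrm{grad}_{(\alpha)}[f_0]+\mathrm{curl}_{(\alpha)}[\vec f],$$ where the first term is the scalar part and the other two form the vector part. *)

theory Defs
  imports "HOL-Analysis.Analysis"
begin

text \<open>
  A complex quaternion \<open>a\<^sub>0 + \<Sum>\<^sub>k a\<^sub>k e\<^sub>k\<close> is the pair \<open>(a\<^sub>0, (a\<^sub>1, a\<^sub>2, a\<^sub>3))\<close> of its scalar and vector
  parts.  Indices range over the type \<open>3\<close>, in which \<open>3 = 0\<close>; the elements \<open>1, 2, 3\<close> are distinct.
\<close>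

type_synonym cquat = "complex \<times> (complex^3)"

definition levi_civita :: "3 \<Rightarrow> 3 \<Rightarrow> 3 \<Rightarrow> int" where
  "levi_civita i j k =
     (if (i, j, k) \<in> {(1, 2, 3), (2, 3, 1), (3, 1, 2)} then 1
      else if (i, j, k) \<in> {(3, 2, 1), (1, 3, 2), (2, 1, 3)} then -1
      else 0)"

definition cq_scalar :: "complex \<Rightarrow> cquat" where
  "cq_scalar z = (z, 0)"

definition cq_vector :: "complex^3 \<Rightarrow> cquat" where
  "cq_vector v = (0, v)"

definition cq_mult :: "cquat \<Rightarrow> cquat \<Rightarrow> cquat" (infixl "\<odot>" 70) where
  "a \<odot> b =
     (fst a * fst b - (\<Sum>k\<in>UNIV. snd a $ k * snd b $ k),
      (\<chi> i. fst a * snd b $ i + snd a $ i * fst b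
            + (\<Sum>j\<in>UNIV. \<Sum>k\<in>UNIV. of_int (levi_civita i j k) * snd a $ j * snd b $ k)))"

lemma cq_units:
  fixes e :: "3 \<Rightarrow> cquat"
  defines "e \<equiv> (\<lambda>k. cq_vector (axis k 1))"
  shows "e 1 \<odot> e 1 = cq_scalar (-1)"
    and "e 2 \<odot> e 2 = cq_scalar (-1)"
    and "e 3 \<odot> e 3 = cq_scalar (-1)"
    and "e 1 \<odot> e 2 \<odot> e 3 = cq_scalar (-1)"
  by (simp_all add: e_def cq_mult_def cq_scalar_def cq_vector_def levi_civita_def
      sum_3 axis_def vec_eq_iff forall_3)

lemma cq_scalar_mult:
  "cq_scalar z \<odot> a = (z * fst a, z *s snd a)"
  "a \<odot> cq_scalar z = (z * fst a, z *s snd a)"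
  by (simp_all add: cq_mult_def cq_scalar_def vec_eq_iff mult.commute)

text \<open>
  The case distinction is needed because \<open>0 powr 0 = 0\<close> in HOL, whereas \<open>|0|\<^sup>0 = 1\<close> here.  For
  \<open>\<alpha> < 1\<close> and \<open>x = 0\<close> the factor \<open>c\<^sub>1\<close> is infinite, and its HOL value is \<open>0\<close>; since \<open>1 / 0 = 0\<close>, the
  quantity \<open>1 / c\<^sub>1\<close>, which is all that the operators use, still has the correct value \<open>0\<close>
  (see the lemmas \<open>inverse_c1\<close> and \<open>inverse_c1_one\<close>).
\<close>

definition c1 :: "real \<Rightarrow> real \<Rightarrow> real" where
  "c1 \<alpha> x = pi powr (\<alpha> / 2) / Gamma (\<alpha> / 2) * (if \<alpha> = 1 then 1 else \<bar>x\<bar> powr (\<alpha> - 1))"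

lemma inverse_c1:
  assumes "\<alpha> < 1"
  shows "1 / c1 \<alpha> x = Gamma (\<alpha> / 2) / pi powr (\<alpha> / 2) * \<bar>x\<bar> powr (1 - \<alpha>)"
  using assms powr_minus[of "\<bar>x\<bar>" "1 - \<alpha>"] by (simp add: c1_def inverse_eq_divide)

lemma inverse_c1_one: "1 / c1 1 x = 1"
  by (simp add: c1_def Gamma_one_half_real powr_half_sqrt)

definition partial_derivative :: "3 \<Rightarrow> (real^3 \<Rightarrow> complex) \<Rightarrow> real^3 \<Rightarrow> complex" where
  "partial_derivative k f x = vector_derivative (\<lambda>t. f (x + t *\<^sub>R axis k 1)) (at 0)"

definition grad_nids :: "real^3 \<Rightarrow> (real^3 \<Rightarrow> complex) \<Rightarrow> real^3 \<Rightarrow> complex^3" where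
  "grad_nids \<alpha> f x =
     (\<chi> k. complex_of_real (1 / c1 (\<alpha> $ k) (x $ k)) * partial_derivative k f x)"

definition div_nids :: "real^3 \<Rightarrow> (real^3 \<Rightarrow> complex^3) \<Rightarrow> real^3 \<Rightarrow> complex" where
  "div_nids \<alpha> g x =
     (\<Sum>k\<in>UNIV. complex_of_real (1 / c1 (\<alpha> $ k) (x $ k)) * partial_derivative k (\<lambda>y. g y $ k) x)"

definition curl_nids :: "real^3 \<Rightarrow> (real^3 \<Rightarrow> complex^3) \<Rightarrow> real^3 \<Rightarrow> complex^3" where
  "curl_nids \<alpha> g x =
     (\<chi> i. \<Sum>j\<in>UNIV. \<Sum>k\<in>UNIV. of_int (levi_civita i j k)
            * complex_of_real (1 / c1 (\<alpha> $ j) (x $ j)) * partial_derivative j (\<lambda>y. g y $ k) x)"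

definition D_MT :: "real^3 \<Rightarrow> (real^3 \<Rightarrow> cquat) \<Rightarrow> real^3 \<Rightarrow> cquat" where
  "D_MT \<alpha> f x =
     cq_scalar (- div_nids \<alpha> (\<lambda>y. snd (f y)) x)
     + cq_vector (grad_nids \<alpha> (\<lambda>y. fst (f y)) x + curl_nids \<alpha> (\<lambda>y. snd (f y)) x)"

text \<open>The diagonal matrix operator \<open>diag(D_MT - l, D_MT + l)\<close> applied to the column \<open>(f, g)\<close>.\<close>

definition M_op ::
  "real^3 \<Rightarrow> complex \<Rightarrow> (real^3 \<Rightarrow> cquat) \<times> (real^3 \<Rightarrow> cquat) \<Rightarrow> real^3 \<Rightarrow> cquat \<times> cquat" where
  "M_op \<alpha> l F x =
     (D_MT \<alpha> (fst F) x - cq_scalar l \<odot> fst F x,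
      D_MT \<alpha> (snd F) x + cq_scalar l \<odot> snd F x)"

definition C1_on ::
  "('a::real_normed_vector) set \<Rightarrow> ('a \<Rightarrow> 'b::real_normed_vector) \<Rightarrow> bool" where
  "C1_on S f \<longleftrightarrow>
     (\<exists>f' :: 'a \<Rightarrow> 'a \<Rightarrow>\<^sub>L 'b.
        (\<forall>x\<in>S. (f has_derivative blinfun_apply (f' x)) (at x)) \<and> continuous_on S f')"

end

theory Submission
  imports Defs
begin

text \<open>
  For divergence-free fields the operator \<open>D_MT\<close> reduces to the curl, so by linearity the two
  quaternionic equations say \<open>curl \<phi> = \<lambda> \<phi>\<close> and \<open>curl \<psi> = - \<lambda> \<psi>\<close>.  Adding them isolates
  \<open>2 \<lambda> curl H = 2 \<lambda> \<sigma> E\<close> and subtracting them \<open>2 \<sigma> curl E = 2 \<lambda>\<^sup>2 H\<close>, where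
  \<open>\<lambda>\<^sup>2 = \<omega>\<^sup>2 \<epsilon> \<mu> = \<sigma> (i \<omega> \<mu>)\<close> and \<open>\<lambda>, \<sigma> \<noteq> 0\<close>.
\<close>

lemma C1_on_imp_differentiable:
  assumes "C1_on S f" "x \<in> S"
  shows "f differentiable (at x)"
  using assms unfolding C1_on_def differentiable_def by blast

text \<open>\<open>vector_derivative\<close> is a choice operator, informative only where a
  derivative exists. The chain rule along the coordinate line supplies existence, which the
  linearity rules below rely on.\<close>

lemma differentiable_imp_has_partial_derivative:
  fixes f :: "real^3 \<Rightarrow> complex^3"
  assumes "f differentiable (at x)"
  shows "((\<lambda>t. f (x + t *\<^sub>R axis k 1) $ m) has_vector_derivative
           partial_derivative k (\<lambda>y. f y $ m) x) (at 0)"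
proof -
  have line: "(\<lambda>t::real. x + t *\<^sub>R axis k 1) differentiable (at 0)"
    by (auto intro!: derivative_intros)
  have "(f \<circ> (\<lambda>t. x + t *\<^sub>R axis k 1)) differentiable (at (0::real))"
    using line assms by (intro differentiable_chain_at) auto
  then have "(\<lambda>t. f (x + t *\<^sub>R axis k 1) $ m) differentiable (at (0::real))"
    by (auto simp: o_def differentiable_def intro: bounded_linear.has_derivative[OF bounded_linear_vec_nth])
  then show ?thesis
    unfolding partial_derivative_def by (simp add: vector_derivative_works)
qed

lemma partial_derivative_lincomb:
  fixes f g :: "real^3 \<Rightarrow> complex^3"
  assumes "f differentiable (at x)" "g differentiable (at x)"
  shows "partial_derivative k (\<lambda>y. (a *s f y + b *s g y) $ m) x
       = a * partial_derivative k (\<lambda>y. f y $ m) x + b * partial_derivative k (\<lambda>y. g y $ m) x"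
proof -
  have "((\<lambda>t. a * f (x + t *\<^sub>R axis k 1) $ m + b * g (x + t *\<^sub>R axis k 1) $ m)
          has_vector_derivative a * partial_derivative k (\<lambda>y. f y $ m) x
            + b * partial_derivative k (\<lambda>y. g y $ m) x) (at 0)"
    by (intro has_vector_derivative_add has_vector_derivative_mult_right
        differentiable_imp_has_partial_derivative assms)
  then show ?thesis
    \<comment> \<open>Only this instance is unfolded, so the two partial derivatives on the right
      stay intact as the value just established.\<close>
    unfolding partial_derivative_def[of k "\<lambda>y. (a *s f y + b *s g y) $ m"]
    by (simp add: vector_derivative_at)
qed

lemma div_nids_lincomb:
  assumes "f differentiable (at x)" "g differentiable (at x)"
  shows "div_nids \<alpha> (\<lambda>y. a *s f y + b *s g y) x = a * div_nids \<alpha> f x + b * div_nids \<alpha> g x"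
  unfolding div_nids_def partial_derivative_lincomb[OF assms]
  by (simp add: sum_3 algebra_simps)

lemma curl_nids_lincomb:
  assumes "f differentiable (at x)" "g differentiable (at x)"
  shows "curl_nids \<alpha> (\<lambda>y. a *s f y + b *s g y) x = a *s curl_nids \<alpha> f x + b *s curl_nids \<alpha> g x"
  unfolding curl_nids_def partial_derivative_lincomb[OF assms]
  by (simp add: vec_eq_iff sum_distrib_left sum.distrib distrib_left mult_ac)

text \<open>The scalar part is constantly 0, so its gradient drops out.\<close>

lemma D_MT_vector:
  "D_MT \<alpha> (\<lambda>y. cq_vector (f y)) x = (- div_nids \<alpha> f x, curl_nids \<alpha> f x)"
  by (simp add: D_MT_def cq_scalar_def cq_vector_def grad_nids_def partial_derivative_def
      vec_eq_iff)

lemma M_op_vector_eq_0_iff: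
  "M_op \<alpha> l (\<lambda>y. cq_vector (f y), \<lambda>y. cq_vector (g y)) x = 0 \<longleftrightarrow>
     div_nids \<alpha> f x = 0 \<and> curl_nids \<alpha> f x = l *s f x \<and>
     div_nids \<alpha> g x = 0 \<and> curl_nids \<alpha> g x = - (l *s g x)"
  unfolding M_op_def fst_conv snd_conv D_MT_vector cq_scalar_mult
  by (simp add: cq_vector_def zero_prod_def eq_neg_iff_add_eq_0)

text \<open>The pointwise algebra left after linearity: \<open>u\<close>, \<open>v\<close> stand for
  the curls of \<open>E\<close>, \<open>H\<close>, and \<open>e\<close>, \<open>h\<close> for their
  values, with \<open>a\<close> = \<sigma> and \<open>m\<close> = i\<omega>\<mu>.\<close>

lemma beltrami_pair_iff:
  fixes u v e h :: "complex^'n" and a l m :: complex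
  assumes "a \<noteq> 0" "l \<noteq> 0" "l\<^sup>2 = a * m"
  shows "a *s u + l *s v = l *s (a *s e + l *s h) \<and>
         - a *s u + l *s v = - (l *s (- a *s e + l *s h))
     \<longleftrightarrow> v = a *s e \<and> u = m *s h"
proof -
  have "a * p + l * q = l * (a * c + l * d) \<and> - a * p + l * q = - (l * (- a * c + l * d))
     \<longleftrightarrow> q = a * c \<and> p = m * d" (is "?L \<longleftrightarrow> ?R") for p q c d
  proof
    assume ?L
    \<comment> \<open>Sum and difference of the two equations. In the second,
      \<open>l\<^sup>2 = a * m\<close> lets \<open>a\<close> be cancelled.\<close>
    then have "2 * l * (q - a * c) = 0" "2 * (a * p - l\<^sup>2 * d) = 0"
      by (algebra, algebra)
    with assms show ?R by auto
  next
    assume ?R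
    then show ?L using assms(3) by algebra
  qed
  then show ?thesis
    \<comment> \<open>Merging the quantifiers over coordinates puts both sides in the shape of the
      scalar equivalence.\<close>
    unfolding vec_eq_iff all_conj_distrib[symmetric]
    by (simp only: vector_add_component vector_smult_component uminus_vec_def vec_lambda_beta)
qed

theorem theorem5p1:
  fixes \<Omega> :: "(real^3) set"
    and \<alpha> :: "real^3"
    and \<omega> \<epsilon> \<mu> \<sigma> s l :: complex
    and E H \<phi> \<psi> :: "real^3 \<Rightarrow> complex^3"
  assumes domain: "open \<Omega>" "connected \<Omega>" "\<Omega> \<noteq> {}"
    and alpha: "\<And>k. 0 < \<alpha> $ k \<and> \<alpha> $ k \<le> 1"
    and nonzero: "\<omega> \<noteq> 0" "\<epsilon> \<noteq> 0" "\<mu> \<noteq> 0"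
    and sigma: "\<sigma> = - \<i> * \<omega> * \<epsilon>"
    and lambda: "s\<^sup>2 = \<epsilon> * \<mu>" "l = \<omega> * s" "Im l \<ge> 0"
    and C1: "C1_on \<Omega> E" "C1_on \<Omega> H"
    and div_free: "\<And>x. x \<in> \<Omega> \<Longrightarrow> div_nids \<alpha> E x = 0" "\<And>x. x \<in> \<Omega> \<Longrightarrow> div_nids \<alpha> H x = 0"
    and phi: "\<phi> = (\<lambda>x. (- \<i> * \<omega> * \<epsilon>) *s E x + l *s H x)"
    and psi: "\<psi> = (\<lambda>x. (\<i> * \<omega> * \<epsilon>) *s E x + l *s H x)"
  shows "(\<forall>x\<in>\<Omega>. M_op \<alpha> l (\<lambda>y. cq_vector (\<phi> y), \<lambda>y. cq_vector (\<psi> y)) x = 0)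
     \<longleftrightarrow> (\<forall>x\<in>\<Omega>. curl_nids \<alpha> H x = \<sigma> *s E x
                \<and> curl_nids \<alpha> E x = (\<i> * \<omega> * \<mu>) *s H x
                \<and> div_nids \<alpha> H x = 0
                \<and> div_nids \<alpha> E x = 0)"
\<comment> \<open>The equivalence already holds at each single point.\<close>
proof (rule ball_cong[OF refl])
  fix x assume x: "x \<in> \<Omega>"
  have diff: "E differentiable (at x)" "H differentiable (at x)"
    using C1 x by (auto intro: C1_on_imp_differentiable)
  \<comment> \<open>\<psi> is \<phi> with \<sigma> negated, the sign pattern of
    \<open>beltrami_pair_iff\<close>.\<close>
  have phi': "\<phi> = (\<lambda>y. \<sigma> *s E y + l *s H y)" and psi': "\<psi> = (\<lambda>y. - \<sigma> *s E y + l *s H y)"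
    by (simp_all add: phi psi sigma)
  have "\<sigma> \<noteq> 0" "s \<noteq> 0"
    using nonzero lambda(1) by (auto simp: sigma)
  moreover from this have "l \<noteq> 0"
    using nonzero by (simp add: lambda(2))
  moreover have "l\<^sup>2 = \<sigma> * (\<i> * \<omega> * \<mu>)"
    by (simp add: lambda sigma power_mult_distrib) (simp add: power2_eq_square algebra_simps)
  ultimately show "M_op \<alpha> l (\<lambda>y. cq_vector (\<phi> y), \<lambda>y. cq_vector (\<psi> y)) x = 0 \<longleftrightarrow>
      curl_nids \<alpha> H x = \<sigma> *s E x \<and> curl_nids \<alpha> E x = (\<i> * \<omega> * \<mu>) *s H x \<and>
      div_nids \<alpha> H x = 0 \<and> div_nids \<alpha> E x = 0"
    \<comment> \<open>By linearity the divergences of \<phi> and \<psi> vanish too, so only the curl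
      equations remain to be compared.\<close>
    using div_free[OF x] beltrami_pair_iff[of \<sigma> l "\<i> * \<omega> * \<mu>" "curl_nids \<alpha> E x"
        "curl_nids \<alpha> H x" "E x" "H x"]
    unfolding M_op_vector_eq_0_iff phi' psi' curl_nids_lincomb[OF diff] div_nids_lincomb[OF diff]
    by simp
qed

end
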